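(* Suppose that for all $K\in\mathcal T$ and $0\le n\le N-1$ one has $\eta>1/\varrho_K^{n+1}$ and $$\delta t\le\frac{|K|\varrho_K^{n+1}}{2\sum_{\sigma\in\mathcal E(K),\,\sigma=K|L}|\sigma|\,\varrho_L^{n+1}\bigl(-(w^n_{\sigma,K})^-\bigr)}.$$ Then there exists a constant $C>0$, independent of $\varepsilon$, such that the discrete solutions $(\varrho^n,\mathbf u^n)_{0\le n\le N}$ of the scheme $[\mathcal P_\varepsilon^{h_{\mathcal T}}]$ satisfy the global energy inequality $$\sum_{K\in\mathcal T}|K|\Bigl(\frac12\varrho_K^n|\mathbf u_K^n|^2+\frac1{\varepsilon^2}\psi_\gamma(\varrho_K^n)\Bigr)+\frac1{\varepsilon^4}\sum_{r=0}^{n-1}\delta t^2\sum_{K\in\mathcal T}|K|\Bigl(\eta-\frac1{\varrho_K^{r+1}}\Bigr)\bigl|(\nabla_{\mathcal T}p^{r+1})_K\bigr|^2\le C.$$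
   Context: **Setting.** $d\in\{2,3\}$; periodic boundary conditions, $\Omega=\mathbb T^d$; $p(\varrho)=\varrho^\gamma$, $\gamma>1$; $\psi_\gamma(\varrho)=\varrho^\gamma/(\gamma-1)$; $\varepsilon>0$. **Mesh.** $\mathcal T$ is a finite family of closed axis-parallel (possibly non-uniform) rectangles/cuboids $K$ covering $\overline\Omega$; two distinct cells share no edge or exactly one edge $\sigma=K|L$. $\mathcal E(K)$: the edges (faces) of $K$; $\mathcal E_{ext}$: edges on $\partial\Omega$; $|K|,|\sigma|$: Lebesgue measures; $\boldsymbol\nu_{\sigma,K}$: unit normal to $\sigma$ outward from $K$. Functions constant on each cell have value $q_K$ on $K$; $(\Pi_{\mathcal T}q)_K=|K|^{-1}\int_Kq\,dx$; $\{\!\{q\}\!\}_\sigma=(q_K+q_L)/2$. **Discrete operators.** $w_{\sigma,K}=\{\!\{\mathbf w\}\!\}_\sigma\cdot\boldsymbol\nu_{\sigma,K}$ if $\sigma=K|L$ and $0$ if $\sigma\in\mathcal E_{ext}$; $(\nabla_{\mathcal T}q)_K=|K|^{-1}\sum_{\sigma=K|L\in\mathcal E(K)}|\sigma|\frac{q_L-q_K}2\boldsymbol\nu_{\sigma,K}$; $(\mathrm{div}^{up}_{\mathcal T}(q,\mathbf w))_K=|K|^{-1}\sum_{\sigma=K|L\in\mathcal E(K)}|\sigma|\{q_K(w_{\sigma,K})^++q_L(w_{\sigma,K})^-\}$ (componentwise for vector $q$). Write $a^\pm=(a\pm|a|)/2$. **Scheme $[\mathcal P_\varepsilon^{h_{\mathcal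 T}}]$.** $t^n=n\,\delta t$, $t^N=T$. $\varrho^0=\Pi_{\mathcal T}\varrho_{0,\varepsilon}$, $\mathbf u^0=\Pi_{\mathcal T}\mathbf u_{0,\varepsilon}$ for given initial data with $\varrho_{0,\varepsilon}>0$; for $0\le n\le N-1$ and all $K$, with $p^{n}_K=p(\varrho^{n}_K)$, $\frac1{\delta t}(\varrho_K^{n+1}-\varrho_K^n)+(\mathrm{div}^{up}_{\mathcal T}(\varrho^{n+1},\mathbf w^n))_K=0$, $\frac1{\delta t}(\varrho_K^{n+1}\mathbf u_K^{n+1}-\varrho_K^n\mathbf u_K^n)+(\mathrm{div}^{up}_{\mathcal T}(\varrho^{n+1}\mathbf u^n,\mathbf w^n))_K+\frac1{\varepsilon^2}(\nabla_{\mathcal T}p^{n+1})_K=0$, where $\mathbf w^n=\mathbf u^n-\delta\mathbf u^{n+1}$, $\delta\mathbf u_K^{n+1}=\frac{\eta\,\delta t}{\varepsilon^2}(\nabla_{\mathcal T}p^{n+1})_K$, $\eta>0$, and $(w^n_{\sigma,K})^+=u_{\sigma,K}^{n,+}-\delta u_{\sigma,K}^{n+1,-}\ge0$, $(w^n_{\sigma,K})^-=u_{\sigma,K}^{n,-}-\delta u_{\sigma,K}^{n+1,+}\le0$. Discrete solutions have $\varrho^n>0$. **Standing assumption.** The initial total energy is bounded uniformly in $\varepsilon$: $\sum_K|K|(\frac12\varrho_K^0|\mathbf u_K^0|^2+\frac1{\varepsilon^2}\psi_\gamma(\varrho_K^0))\le C_0$ with $C_0$ independent of $\varepsilon$. 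*)

theory Defs
  imports "HOL-Analysis.Analysis"
begin

text \<open>
  The torus is the product of the circles \<open>\<real> / (per $ i) \<int>\<close>, with fundamental domain
  \<open>cbox 0 per\<close>; the unit torus is the case where every \<open>per $ i\<close> is 1.  A cell is a box in this
  domain, and a function that is constant on each cell is a function of the cell.
\<close>

type_synonym 'd cell = "(real ^ 'd) set"

section \<open>Periodic meshes\<close>

text \<open>
  The faces of a box correspond to its outward unit normals, so an edge \<open>\<sigma>\<close> of \<open>K\<close> is
  given by the pair \<open>(K, \<nu>)\<close> with \<open>\<nu> = \<nu>\<^bsub>\<sigma>,K\<^esub>\<close>.
\<close>

definition normals :: "(real ^ 'd) set" where
  "normals = Basis \<union> uminus ` Basis"

definition face :: "'d cell \<Rightarrow> real ^ 'd \<Rightarrow> (real ^ 'd) set" where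
  "face K \<nu> = {x \<in> K. \<forall>y\<in>K. y \<bullet> \<nu> \<le> x \<bullet> \<nu>}"

text \<open>
  An edge as a subset of the torus, represented by its preimage in the covering space.
  Opposite sides of \<open>cbox 0 per\<close> are thereby identified, so that no edge lies on a boundary.
\<close>

definition edge :: "real ^ 'd \<Rightarrow> 'd cell \<Rightarrow> real ^ 'd \<Rightarrow> (real ^ 'd) set" where
  "edge per K \<nu> = {x. \<exists>k :: 'd \<Rightarrow> int. x + (\<chi> i. of_int (k i) * per $ i) \<in> face K \<nu>}"

definition edges :: "real ^ 'd \<Rightarrow> 'd cell \<Rightarrow> (real ^ 'd) set set" where
  "edges per K = edge per K ` normals"

text \<open>The relation \<open>\<sigma> = K|L\<close>, where \<open>\<sigma>\<close> is the edge of \<open>K\<close> with outward normal \<open>\<nu>\<close>.\<close>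

definition common_edge :: "real ^ 'd \<Rightarrow> 'd cell \<Rightarrow> real ^ 'd \<Rightarrow> 'd cell \<Rightarrow> bool" where
  "common_edge per K \<nu> L \<longleftrightarrow> L \<noteq> K \<and> edge per K \<nu> \<in> edges per L"

definition periodic_mesh :: "real ^ 'd \<Rightarrow> 'd cell set \<Rightarrow> bool" where
  "periodic_mesh per \<T> \<longleftrightarrow>
     (\<forall>i. 0 < per $ i) \<and>
     \<T> division_of (cbox 0 per) \<and>
     (\<forall>K\<in>\<T>. interior K \<noteq> {}) \<and>
     (\<forall>K\<in>\<T>. \<forall>L\<in>\<T>. K \<noteq> L \<longrightarrow> card (edges per K \<inter> edges per L) \<le> 1) \<and>
     (\<forall>K\<in>\<T>. \<forall>\<nu>\<in>normals. \<exists>L\<in>\<T>. common_edge per K \<nu> L)"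

definition vol :: "'d::finite cell \<Rightarrow> real" where
  "vol K = measure lborel K"

text \<open>
  The \<open>(d-1)\<close>-dimensional Lebesgue measure of a face, as the \<open>d\<close>-dimensional measure of the
  prism of unit height over it.
\<close>

definition area :: "'d cell \<Rightarrow> real ^ 'd \<Rightarrow> real" where
  "area K \<nu> = measure lborel {x + s *\<^sub>R \<nu> | x s. x \<in> face K \<nu> \<and> 0 \<le> s \<and> s \<le> 1}"

text \<open>The sum over all \<open>\<sigma> = K|L\<close> in \<open>\<E>(K)\<close>.\<close>

definition edge_sum ::
  "real ^ 'd \<Rightarrow> 'd cell set \<Rightarrow> 'd cell \<Rightarrow> (real ^ 'd \<Rightarrow> 'd cell \<Rightarrow> 'b::comm_monoid_add) \<Rightarrow> 'b" where
  "edge_sum per \<T> K f = (\<Sum>\<nu>\<in>normals. \<Sum>L\<in>{L\<in>\<T>. common_edge per K \<nu> L}. f \<nu> L)"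

section \<open>Discrete operators\<close>

definition cell_average ::
  "(real ^ 'd \<Rightarrow> 'b::{banach, second_countable_topology}) \<Rightarrow> 'd cell \<Rightarrow> 'b" where
  "cell_average q K = (1 / vol K) *\<^sub>R (LINT x:K|lborel. q x)"

definition pos_part :: "real \<Rightarrow> real" where
  "pos_part a = (a + \<bar>a\<bar>) / 2"

definition neg_part :: "real \<Rightarrow> real" where
  "neg_part a = (a - \<bar>a\<bar>) / 2"

definition normal_vel ::
  "('d cell \<Rightarrow> real ^ 'd) \<Rightarrow> 'd cell \<Rightarrow> real ^ 'd \<Rightarrow> 'd cell \<Rightarrow> real" where
  "normal_vel w K \<nu> L = ((1/2) *\<^sub>R (w K + w L)) \<bullet> \<nu>"

definition disc_grad ::
  "real ^ 'd \<Rightarrow> 'd cell set \<Rightarrow> ('d cell \<Rightarrow> real) \<Rightarrow> 'd cell \<Rightarrow> real ^ 'd" where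
  "disc_grad per \<T> q K =
     (1 / vol K) *\<^sub>R edge_sum per \<T> K (\<lambda>\<nu> L. (area K \<nu> * ((q L - q K) / 2)) *\<^sub>R \<nu>)"

text \<open>
  For the scheme's velocity \<open>w = u - v\<close>, with \<open>v\<close> the stabilisation, the upwind fluxes use the
  splitting below of \<open>w\<^bsub>\<sigma>,K\<^esub>\<close> into a nonnegative and a nonpositive part.  It differs in
  general from \<open>pos_part\<close> and \<open>neg_part\<close> of \<open>w\<^bsub>\<sigma>,K\<^esub>\<close>.
\<close>

definition w_plus ::
  "('d cell \<Rightarrow> real ^ 'd) \<Rightarrow> ('d cell \<Rightarrow> real ^ 'd) \<Rightarrow> 'd cell \<Rightarrow> real ^ 'd \<Rightarrow> 'd cell \<Rightarrow> real" where
  "w_plus u v K \<nu> L = pos_part (normal_vel u K \<nu> L) - neg_part (normal_vel v K \<nu> L)"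

definition w_minus ::
  "('d cell \<Rightarrow> real ^ 'd) \<Rightarrow> ('d cell \<Rightarrow> real ^ 'd) \<Rightarrow> 'd cell \<Rightarrow> real ^ 'd \<Rightarrow> 'd cell \<Rightarrow> real" where
  "w_minus u v K \<nu> L = neg_part (normal_vel u K \<nu> L) - pos_part (normal_vel v K \<nu> L)"

lemma w_plus_nonneg: "0 \<le> w_plus u v K \<nu> L"
  and w_minus_nonpos: "w_minus u v K \<nu> L \<le> 0"
  and w_plus_add_w_minus:
    "w_plus u v K \<nu> L + w_minus u v K \<nu> L = normal_vel (\<lambda>K. u K - v K) K \<nu> L"
proof -
  show "0 \<le> w_plus u v K \<nu> L" "w_minus u v K \<nu> L \<le> 0"
    by (simp_all add: w_plus_def w_minus_def pos_part_def neg_part_def abs_if)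
  show "w_plus u v K \<nu> L + w_minus u v K \<nu> L = normal_vel (\<lambda>K. u K - v K) K \<nu> L"
    by (simp add: w_plus_def w_minus_def pos_part_def neg_part_def normal_vel_def
        inner_diff_left inner_add_left field_simps)
qed

definition div_up ::
  "real ^ 'd \<Rightarrow> 'd cell set \<Rightarrow> ('d cell \<Rightarrow> 'b::real_vector) \<Rightarrow>
   ('d cell \<Rightarrow> real ^ 'd) \<Rightarrow> ('d cell \<Rightarrow> real ^ 'd) \<Rightarrow> 'd cell \<Rightarrow> 'b" where
  "div_up per \<T> q u v K =
     (1 / vol K) *\<^sub>R edge_sum per \<T> K
       (\<lambda>\<nu> L. area K \<nu> *\<^sub>R (w_plus u v K \<nu> L *\<^sub>R q K + w_minus u v K \<nu> L *\<^sub>R q L))"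

section \<open>The scheme\<close>

definition pressure :: "real \<Rightarrow> real \<Rightarrow> real" where
  "pressure \<gamma> r = r powr \<gamma>"

definition psi :: "real \<Rightarrow> real \<Rightarrow> real" where
  "psi \<gamma> r = r powr \<gamma> / (\<gamma> - 1)"

definition grad_p ::
  "real ^ 'd \<Rightarrow> 'd cell set \<Rightarrow> real \<Rightarrow> ('d cell \<Rightarrow> real) \<Rightarrow> 'd cell \<Rightarrow> real ^ 'd" where
  "grad_p per \<T> \<gamma> \<rho> = disc_grad per \<T> (\<lambda>K. pressure \<gamma> (\<rho> K))"

text \<open>The stabilisation \<open>\<delta>u\<^sup>n\<^sup>+\<^sup>1\<close>, as a function of the density \<open>\<rho>\<^sup>n\<^sup>+\<^sup>1\<close>.\<close>

definition stab ::
  "real ^ 'd \<Rightarrow> 'd cell set \<Rightarrow> real \<Rightarrow> real \<Rightarrow> real \<Rightarrow> real \<Rightarrow> ('d cell \<Rightarrow> real) \<Rightarrow>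
   'd cell \<Rightarrow> real ^ 'd" where
  "stab per \<T> \<gamma> \<epsilon> \<eta> \<delta>t \<rho> K = (\<eta> * \<delta>t / \<epsilon>\<^sup>2) *\<^sub>R grad_p per \<T> \<gamma> \<rho> K"

definition energy ::
  "'d cell set \<Rightarrow> real \<Rightarrow> real \<Rightarrow> ('d cell \<Rightarrow> real) \<Rightarrow> ('d cell \<Rightarrow> real ^ 'd) \<Rightarrow> real" where
  "energy \<T> \<gamma> \<epsilon> \<rho> u =
     (\<Sum>K\<in>\<T>. vol K * (1/2 * \<rho> K * (norm (u K))\<^sup>2 + 1 / \<epsilon>\<^sup>2 * psi \<gamma> (\<rho> K)))"

definition discrete_solution ::
  "real ^ 'd \<Rightarrow> 'd cell set \<Rightarrow> real \<Rightarrow> real \<Rightarrow> real \<Rightarrow> real \<Rightarrow> real \<Rightarrow> nat \<Rightarrow>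
   (real ^ 'd \<Rightarrow> real) \<Rightarrow> (real ^ 'd \<Rightarrow> real ^ 'd) \<Rightarrow>
   (nat \<Rightarrow> 'd cell \<Rightarrow> real) \<Rightarrow> (nat \<Rightarrow> 'd cell \<Rightarrow> real ^ 'd) \<Rightarrow> bool" where
  "discrete_solution per \<T> \<gamma> \<epsilon> \<eta> T \<delta>t N \<rho>\<^sub>0 u\<^sub>0 \<rho> u \<longleftrightarrow>
     0 < \<delta>t \<and> real N * \<delta>t = T \<and>
     (\<forall>K\<in>\<T>. \<rho> 0 K = cell_average \<rho>\<^sub>0 K \<and> u 0 K = cell_average u\<^sub>0 K) \<and>
     (\<forall>n\<le>N. \<forall>K\<in>\<T>. 0 < \<rho> n K) \<and>
     (\<forall>n<N. \<forall>K\<in>\<T>.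
        (let v = stab per \<T> \<gamma> \<epsilon> \<eta> \<delta>t (\<rho> (Suc n)) in
           1 / \<delta>t * (\<rho> (Suc n) K - \<rho> n K)
             + div_up per \<T> (\<rho> (Suc n)) (u n) v K = 0 \<and>
           (1 / \<delta>t) *\<^sub>R (\<rho> (Suc n) K *\<^sub>R u (Suc n) K - \<rho> n K *\<^sub>R u n K)
             + div_up per \<T> (\<lambda>K. \<rho> (Suc n) K *\<^sub>R u n K) (u n) v K
             + (1 / \<epsilon>\<^sup>2) *\<^sub>R grad_p per \<T> \<gamma> (\<rho> (Suc n)) K = 0))"

text \<open>
  When the denominator vanishes the restriction on the time step is void, whereas the
  convention \<open>x / 0 = 0\<close> would make it unsatisfiable.
\<close>

definition time_step_condition ::
  "real ^ 'd \<Rightarrow> 'd cell set \<Rightarrow> real \<Rightarrow> real \<Rightarrow> real \<Rightarrow> real \<Rightarrow>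
   (nat \<Rightarrow> 'd cell \<Rightarrow> real) \<Rightarrow> (nat \<Rightarrow> 'd cell \<Rightarrow> real ^ 'd) \<Rightarrow> nat \<Rightarrow> 'd cell \<Rightarrow> bool" where
  "time_step_condition per \<T> \<gamma> \<epsilon> \<eta> \<delta>t \<rho> u n K \<longleftrightarrow>
     (let v = stab per \<T> \<gamma> \<epsilon> \<eta> \<delta>t (\<rho> (Suc n));
          D = 2 * edge_sum per \<T> K
                (\<lambda>\<nu> L. area K \<nu> * \<rho> (Suc n) L * (- w_minus (u n) v K \<nu> L))
      in D \<noteq> 0 \<longrightarrow> \<delta>t \<le> vol K * \<rho> (Suc n) K / D)"

end

theory Submission
  imports Defs
begin

text \<open>
  Multiplying the momentum balance by \<open>u\<^bsub>K\<^esub>\<^sup>n\<close>, the mass balance by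
  \<open>\<psi>\<^sub>\<gamma>'(\<rho>\<^bsub>K\<^esub>\<^sup>n\<^sup>+\<^sup>1)/\<epsilon>\<^sup>2\<close> and summing over \<open>K\<close>, the
  convective fluxes cancel by conservativity, and duality of gradient and divergence cancels the
  pressure work except for the stabilisation, which leaves the dissipation \<open>\<eta> |\<nabla>p|\<^sup>2\<close>.
  The explicit treatment of the velocity produces the positive remainder
  \<open>\<rho>\<^bsub>K\<^esub>\<^sup>n\<^sup>+\<^sup>1 |u\<^bsub>K\<^esub>\<^sup>n\<^sup>+\<^sup>1 - u\<^bsub>K\<^esub>\<^sup>n|\<^sup>2 / 2\<close>.  By the momentum balance, Cauchy-Schwarz and
  the time step restriction it is absorbed by the upwind dissipation, up to a term
  \<open>|\<nabla>p|\<^sup>2 / \<rho>\<^bsub>K\<^esub>\<^sup>n\<^sup>+\<^sup>1\<close>.  Hence the energy at time \<open>n\<close> plus the accumulated dissipation is at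
  most the initial energy.
\<close>

section \<open>Geometry of periodic meshes\<close>

lemma int_multiple_less_period:
  fixes p :: real and k :: int
  assumes "\<bar>of_int k * p\<bar> < p"
  shows "k = 0"
proof (rule ccontr)
  assume "k \<noteq> 0"
  then have "1 * \<bar>p\<bar> \<le> \<bar>of_int k\<bar> * \<bar>p\<bar>" by (intro mult_right_mono) auto
  then show False using assms unfolding abs_mult by linarith
qed

text \<open>Points of the open interval lie strictly between 0 and \<open>p\<close>, so a translate
  that lands in \<open>{a'..b'}\<close>, within the same period, is the trivial one. The end points
  follow by closure; they cannot be treated directly because 0 and \<open>p\<close> are the same
  point of the circle.\<close>

lemma periodic_interval_subset:
  fixes p :: real
  assumes "0 \<le> a" "a < b" "b \<le> p" "0 \<le> a'" "b' \<le> p"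
    and "{t. \<exists>k::int. t + of_int k * p \<in> {a..b}} \<subseteq> {t. \<exists>k::int. t + of_int k * p \<in> {a'..b'}}"
  shows "a' \<le> a \<and> b \<le> b'"
proof -
  have "{a<..<b} \<subseteq> {a'..b'}"
  proof
    fix t assume t: "t \<in> {a<..<b}"
    then have "\<exists>k::int. t + of_int k * p \<in> {a..b}"
      by (intro exI[of _ 0]) auto
    then obtain k :: int where k: "t + of_int k * p \<in> {a'..b'}"
      using assms(6) by blast
    have "k = 0" using t k assms by (intro int_multiple_less_period[of k p]) auto
    then show "t \<in> {a'..b'}" using k by simp
  qed
  then show ?thesis
    using \<open>a < b\<close> by (simp add: greaterThanLessThan_subseteq_atLeastAtMost_iff)
qed

text \<open>Two distinct points of the open interval are less than \<open>p\<close> apart, so they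
  cannot both be translates of \<open>c\<close>. This distinguishes tangential from normal
  directions of an edge.\<close>

lemma periodic_interval_not_subset_point:
  fixes p :: real
  assumes "0 \<le> a" "a < b" "b \<le> p"
  shows "\<not> {t. \<exists>k::int. t + of_int k * p \<in> {a..b}} \<subseteq> {t. \<exists>k::int. t + of_int k * p \<in> {c}}"
proof
  assume sub: "{t. \<exists>k::int. t + of_int k * p \<in> {a..b}} \<subseteq> {t. \<exists>k::int. t + of_int k * p \<in> {c}}"
  define t s where "t = (a + b) / 2" and "s = (a + t) / 2"
  have ts: "a < s" "s < t" "t < b" using assms by (auto simp: t_def s_def)
  have "\<exists>k::int. t + of_int k * p \<in> {a..b}" "\<exists>k::int. s + of_int k * p \<in> {a..b}"
    using ts by (auto intro!: exI[of _ "0::int"])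
  then obtain k l :: int where "t + of_int k * p = c" "s + of_int l * p = c"
    using sub by blast
  then have eq: "t - s + of_int (k - l) * p = 0" by (simp add: algebra_simps)
  have "k - l = 0"
    by (rule int_multiple_less_period[of _ p]) (use ts assms eq in linarith)
  then show False using eq ts by simp
qed

section \<open>Faces and edges of boxes in coordinates\<close>

lemma axis_in_normals_cases:
  fixes \<nu> :: "real ^ 'd"
  assumes "\<nu> \<in> normals"
  obtains i where "\<nu> = axis i 1" | i where "\<nu> = - axis i 1"
  using assms by (auto simp: normals_def Basis_vec_def)

lemma uminus_normals_iff [simp]:
  "- (\<nu> :: real ^ 'd) \<in> normals \<longleftrightarrow> \<nu> \<in> normals"
  by (auto simp: normals_def image_iff) (metis minus_minus)

lemma finite_normals [simp]: "finite (normals :: (real ^ 'd) set)"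
  by (simp add: normals_def)

lemma axis_nth_if: "axis i x $ j = (if j = i then x else 0)"
  by (simp add: axis_def)

text \<open>A face of a box is again a product of intervals. This is its factor number
  \<open>j\<close>, a single point in the direction of the normal.\<close>

definition face_interval :: "real ^ 'd \<Rightarrow> real ^ 'd \<Rightarrow> real ^ 'd \<Rightarrow> 'd \<Rightarrow> real set" where
  "face_interval a b \<nu> j =
     (if \<nu> $ j = 0 then {a $ j..b $ j} else if \<nu> $ j > 0 then {b $ j} else {a $ j})"

lemma face_cbox:
  fixes a b :: "real ^ 'd"
  assumes "\<And>j. a $ j \<le> b $ j" "\<nu> \<in> normals"
  shows "face (cbox a b) \<nu> = {x. \<forall>j. x $ j \<in> face_interval a b \<nu> j}"
  using assms(2)
proof (cases rule: axis_in_normals_cases)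
  case (1 i)
  have "b \<in> cbox a b" using assms(1) by (simp add: mem_box_cart)
  then have "face (cbox a b) \<nu> = {x \<in> cbox a b. x $ i = b $ i}"
    unfolding face_def 1 inner_axis by (auto simp: mem_box_cart intro: antisym)
  then show ?thesis
    using assms(1) by (auto simp: 1 mem_box_cart face_interval_def axis_nth_if)
next
  case (2 i)
  have "a \<in> cbox a b" using assms(1) by (simp add: mem_box_cart)
  then have "face (cbox a b) \<nu> = {x \<in> cbox a b. x $ i = a $ i}"
    unfolding face_def 2 inner_minus_right inner_axis by (auto simp: mem_box_cart intro: antisym)
  then show ?thesis
    using assms(1) by (auto simp: 2 mem_box_cart face_interval_def axis_nth_if)
qed

text \<open>The integer shifts are chosen independently in each coordinate, so the periodic preimage
  of a product is the product of the periodic preimages.\<close>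

lemma edge_cbox:
  fixes a b :: "real ^ 'd"
  assumes "\<And>j. a $ j \<le> b $ j" "\<nu> \<in> normals"
  shows "edge per (cbox a b) \<nu> =
    {x. \<forall>j. x $ j \<in> {t. \<exists>k::int. t + of_int k * per $ j \<in> face_interval a b \<nu> j}}"
  unfolding edge_def face_cbox[OF assms] by (auto simp: choice_iff)

text \<open>Equal products of nonempty sets have equal factors: a point of one product is varied in
  the single coordinate \<open>j\<close> and read off in the other.\<close>

lemma edge_eq_face_interval:
  fixes a b a' b' :: "real ^ 'd"
  assumes ab: "\<And>j. a $ j \<le> b $ j" and ab': "\<And>j. a' $ j \<le> b' $ j"
    and "\<nu> \<in> normals" "\<mu> \<in> normals"
    and eq: "edge per (cbox a b) \<nu> = edge per (cbox a' b') \<mu>"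
  shows "{t. \<exists>k::int. t + of_int k * per $ j \<in> face_interval a b \<nu> j} =
         {t. \<exists>k::int. t + of_int k * per $ j \<in> face_interval a' b' \<mu> j}"
    (is "?E j = ?E' j")
proof -
  have "\<exists>t. t \<in> ?E j" for j
    using ab[of j]
    by (intro exI[of _ "if \<nu> $ j > 0 then b $ j else a $ j"])
      (auto simp: face_interval_def intro!: exI[of _ "0::int"])
  then obtain x where x: "\<And>j. x j \<in> ?E j" by metis
  have "\<exists>t. t \<in> ?E' j" for j
    using ab'[of j]
    by (intro exI[of _ "if \<mu> $ j > 0 then b' $ j else a' $ j"])
      (auto simp: face_interval_def intro!: exI[of _ "0::int"])
  then obtain y where y: "\<And>j. y j \<in> ?E' j" by metis
  have sub: "{x. \<forall>j. x $ j \<in> ?E j} = {x. \<forall>j. x $ j \<in> ?E' j}"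
    using eq unfolding edge_cbox[OF ab \<open>\<nu> \<in> normals\<close>] edge_cbox[OF ab' \<open>\<mu> \<in> normals\<close>] .
  show ?thesis
  proof (intro set_eqI iffI)
    fix t assume "t \<in> ?E j"
    then have "(\<chi> l. if l = j then t else x l) \<in> {x. \<forall>j. x $ j \<in> ?E j}"
      using x by simp
    then have "(\<chi> l. if l = j then t else x l) $ j \<in> ?E' j" unfolding sub by blast
    then show "t \<in> ?E' j" by simp
  next
    fix t assume "t \<in> ?E' j"
    then have "(\<chi> l. if l = j then t else y l) \<in> {x. \<forall>j. x $ j \<in> ?E' j}"
      using y by simp
    then have "(\<chi> l. if l = j then t else y l) $ j \<in> ?E j" unfolding sub[symmetric] by blast
    then show "t \<in> ?E j" by simp
  qed
qed

lemma area_cbox: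
  fixes a b :: "real ^ 'd"
  assumes ab: "\<And>j. a $ j \<le> b $ j" and "\<nu> \<in> normals"
  shows "area (cbox a b) \<nu> = (\<Prod>j | \<nu> $ j = 0. b $ j - a $ j)"
proof -
  \<comment> \<open>The prism over the face is the box from \<open>l\<close> to \<open>h\<close>: it
    sticks out of the face by length 1 along the normal, so its normal side contributes the factor 1
    to the volume.\<close>
  define l h where "l = (\<chi> j. if \<nu> $ j = 0 then a $ j else if \<nu> $ j > 0 then b $ j else a $ j - 1)"
    and "h = (\<chi> j. if \<nu> $ j = 0 then b $ j else if \<nu> $ j > 0 then b $ j + 1 else a $ j)"
  have "{x + s *\<^sub>R \<nu> | x s. x \<in> face (cbox a b) \<nu> \<and> 0 \<le> s \<and> s \<le> 1} = cbox l h"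
  proof (intro set_eqI iffI)
    fix y assume "y \<in> {x + s *\<^sub>R \<nu> | x s. x \<in> face (cbox a b) \<nu> \<and> 0 \<le> s \<and> s \<le> 1}"
    then obtain x s where y: "y = x + s *\<^sub>R \<nu>" "0 \<le> s" "s \<le> 1"
      and x: "\<And>j. x $ j \<in> face_interval a b \<nu> j"
      unfolding face_cbox[OF ab \<open>\<nu> \<in> normals\<close>] by blast
    have "l $ j \<le> y $ j \<and> y $ j \<le> h $ j" for j
      using \<open>\<nu> \<in> normals\<close>
      by (cases rule: axis_in_normals_cases)
        (use x[of j] y ab[of j] in \<open>auto simp: l_def h_def face_interval_def axis_nth_if split: if_splits\<close>)
    then show "y \<in> cbox l h" by (simp add: mem_box_cart)
  next
    fix y assume y: "y \<in> cbox l h"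
    show "y \<in> {x + s *\<^sub>R \<nu> | x s. x \<in> face (cbox a b) \<nu> \<and> 0 \<le> s \<and> s \<le> 1}"
      using \<open>\<nu> \<in> normals\<close>
    proof (cases rule: axis_in_normals_cases)
      case (1 i)
      \<comment> \<open>Moving \<open>y\<close> back along the normal onto the plane of the face
        gives the base point; the distance moved is the height \<open>s\<close>.\<close>
      have "y - (y $ i - b $ i) *\<^sub>R \<nu> \<in> face (cbox a b) \<nu>" "b $ i \<le> y $ i" "y $ i \<le> b $ i + 1"
        using y ab unfolding face_cbox[OF ab \<open>\<nu> \<in> normals\<close>]
        by (auto simp: 1 mem_box_cart l_def h_def face_interval_def axis_nth_if split: if_splits)
      then show ?thesis
        by (intro CollectI exI[of _ "y - (y $ i - b $ i) *\<^sub>R \<nu>"] exI[of _ "y $ i - b $ i"]) simp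
    next
      case (2 i)
      have "y - (a $ i - y $ i) *\<^sub>R \<nu> \<in> face (cbox a b) \<nu>" "y $ i \<le> a $ i" "a $ i - 1 \<le> y $ i"
        using y ab unfolding face_cbox[OF ab \<open>\<nu> \<in> normals\<close>]
        by (auto simp: 2 mem_box_cart l_def h_def face_interval_def axis_nth_if split: if_splits)
      then show ?thesis
        by (intro CollectI exI[of _ "y - (a $ i - y $ i) *\<^sub>R \<nu>"] exI[of _ "a $ i - y $ i"]) simp
    qed
  qed
  moreover have "cbox l h \<noteq> {}"
    using ab by (auto simp: interval_ne_empty_cart l_def h_def)
  ultimately have "area (cbox a b) \<nu> = (\<Prod>j\<in>UNIV. h $ j - l $ j)"
    by (simp add: area_def content_cbox_cart)
  also have "\<dots> = (\<Prod>j\<in>UNIV. if \<nu> $ j = 0 then b $ j - a $ j else 1)"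
    by (intro prod.cong) (auto simp: l_def h_def)
  also have "\<dots> = (\<Prod>j | \<nu> $ j = 0. b $ j - a $ j)"
    by (simp add: prod.If_cases)
  finally show ?thesis .
qed

section \<open>Cells of a mesh and the matching of their edges\<close>

lemma periodic_mesh_cellE:
  assumes "periodic_mesh per \<T>" "K \<in> \<T>"
  obtains a b where "K = cbox a b" "\<And>j. a $ j < b $ j" "\<And>j. 0 \<le> a $ j" "\<And>j. b $ j \<le> per $ j"
proof -
  have "\<T> division_of cbox 0 per" "interior K \<noteq> {}"
    using assms by (auto simp: periodic_mesh_def)
  then obtain a b where K: "K = cbox a b" "K \<subseteq> cbox 0 per"
    using assms by (meson division_ofD(2,4))
  have "box a b \<noteq> {}" using \<open>interior K \<noteq> {}\<close> K by simp
  then have lt: "\<And>j. a $ j < b $ j" by (simp add: interval_ne_empty_cart)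
  then have "a \<in> cbox 0 per" "b \<in> cbox 0 per"
    using K by (auto simp: mem_box_cart less_imp_le subset_iff)
  then show thesis using that[OF K(1) lt] by (simp add: mem_box_cart)
qed

lemma vol_pos:
  assumes "periodic_mesh per \<T>" "K \<in> \<T>"
  shows "0 < vol K"
  using assms
proof (rule periodic_mesh_cellE)
  fix a b assume "K = cbox a b" and lt: "\<And>j. a $ j < b $ j"
  moreover have "cbox a b \<noteq> {}" using lt by (simp add: interval_ne_empty_cart less_imp_le)
  ultimately show "0 < vol K" by (auto simp: vol_def content_cbox_cart intro!: prod_pos)
qed

text \<open>
  The edge seen from \<open>L\<close> has normal \<open>-\<nu>\<close>: with normal \<open>\<nu>\<close>, both cells would lie on the same
  side of their common face and their interiors would overlap.
\<close>

lemma common_edge_opposite: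
  fixes per :: "real ^ 'd"
  assumes mesh: "periodic_mesh per \<T>" and KL: "K \<in> \<T>" "L \<in> \<T>" and \<nu>: "\<nu> \<in> normals"
    and ce: "common_edge per K \<nu> L"
  shows "edge per K \<nu> = edge per L (- \<nu>)" and "area L (- \<nu>) = area K \<nu>"
proof -
  obtain a b where K: "K = cbox a b" and ab: "\<And>j. a $ j < b $ j"
    and a0: "\<And>j. 0 \<le> a $ j" and bp: "\<And>j. b $ j \<le> per $ j"
    using periodic_mesh_cellE[OF mesh KL(1)] by metis
  obtain a' b' where L: "L = cbox a' b'" and ab': "\<And>j. a' $ j < b' $ j"
    and a0': "\<And>j. 0 \<le> a' $ j" and bp': "\<And>j. b' $ j \<le> per $ j"
    using periodic_mesh_cellE[OF mesh KL(2)] by metis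
  obtain \<mu> where \<mu>: "\<mu> \<in> normals" and eq: "edge per K \<nu> = edge per L \<mu>" and "L \<noteq> K"
    using ce by (auto simp: common_edge_def edges_def)
  define P where "P j S = {t. \<exists>k::int. t + of_int k * per $ j \<in> S}" for j S
  have E: "P j (face_interval a b \<nu> j) = P j (face_interval a' b' \<mu> j)" for j
    unfolding P_def
    by (rule edge_eq_face_interval[OF less_imp_le[OF ab] less_imp_le[OF ab'] \<nu> \<mu> eq[unfolded K L]])
  have point: "\<not> P j {a $ j..b $ j} \<subseteq> P j {c}" "\<not> P j {a' $ j..b' $ j} \<subseteq> P j {c}" for j c
    unfolding P_def using a0 ab bp a0' ab' bp' by (intro periodic_interval_not_subset_point; simp)+
  \<comment> \<open>Both normals lie on the same axis: otherwise an interval of positive length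
    would consist of translates of a single point.\<close>
  have zero: "\<nu> $ j = 0 \<longleftrightarrow> \<mu> $ j = 0" for j
  proof (rule ccontr)
    assume "\<not> ?thesis"
    then consider "\<nu> $ j = 0" "\<mu> $ j \<noteq> 0" | "\<nu> $ j \<noteq> 0" "\<mu> $ j = 0" by blast
    then show False
    proof cases
      case 1
      then obtain c where "P j {a $ j..b $ j} = P j {c}"
        using E[of j] by (cases "\<mu> $ j > 0") (simp_all add: face_interval_def)
      then show False using point(1) by blast
    next
      case 2
      then obtain c where "P j {a' $ j..b' $ j} = P j {c}"
        using E[of j, symmetric] by (cases "\<nu> $ j > 0") (simp_all add: face_interval_def)
      then show False using point(2) by blast
    qed
  qed
  \<comment> \<open>Tangential factors have positive length and lie in one period, so they agree as
    intervals and not only up to translation. The areas then agree as well.\<close>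
  have same: "a $ j = a' $ j \<and> b $ j = b' $ j" if "\<nu> $ j = 0" for j
  proof -
    have "P j {a $ j..b $ j} = P j {a' $ j..b' $ j}"
      using E[of j] that zero[of j] by (simp add: face_interval_def)
    then have "P j {a $ j..b $ j} \<subseteq> P j {a' $ j..b' $ j}" "P j {a' $ j..b' $ j} \<subseteq> P j {a $ j..b $ j}"
      by simp_all
    from periodic_interval_subset[OF a0 ab bp a0' bp' this(1)[unfolded P_def]]
      periodic_interval_subset[OF a0' ab' bp' a0 bp this(2)[unfolded P_def]]
    show ?thesis by simp
  qed
  have area_eq: "area L (- \<nu>) = area K \<nu>"
    using same \<nu> by (auto simp: K L area_cbox less_imp_le[OF ab] less_imp_le[OF ab'] intro!: prod.cong)
  have disj: "interior K \<inter> interior L = {}"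
    using mesh KL \<open>L \<noteq> K\<close> division_ofD(5) unfolding periodic_mesh_def by metis
  have "\<mu> = - \<nu>"
  proof (rule ccontr)
    assume ne: "\<mu> \<noteq> - \<nu>"
    have "\<mu> = \<nu>"
      using \<nu>
    proof (cases rule: axis_in_normals_cases)
      case (1 i)
      from \<mu> show ?thesis
        by (cases rule: axis_in_normals_cases)
          (use ne zero[of i] 1 in \<open>auto simp: axis_nth_if split: if_splits\<close>)
    next
      case (2 i)
      from \<mu> show ?thesis
        by (cases rule: axis_in_normals_cases)
          (use ne zero[of i] 2 in \<open>auto simp: axis_nth_if split: if_splits\<close>)
    qed
    \<comment> \<open>In the normal coordinate both upper ends lie above 0 and at most at the
      period, and both lower ends lie in the period without its right end. Translates of each other
      are therefore equal, and the two boxes overlap.\<close>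
    have "max (a $ j) (a' $ j) < min (b $ j) (b' $ j)" for j
    proof (cases "\<nu> $ j = 0")
      case True
      then show ?thesis using same[of j] ab[of j] by simp
    next
      case nz: False
      show ?thesis
      proof (cases "\<nu> $ j > 0")
        case True
        then have "P j {b $ j} = P j {b' $ j}"
          using E[of j] nz \<open>\<mu> = \<nu>\<close> by (simp add: face_interval_def)
        moreover have "b $ j \<in> P j {b $ j}" by (auto simp: P_def intro: exI[of _ 0])
        ultimately obtain k :: int where k: "b $ j + of_int k * per $ j = b' $ j"
          by (auto simp: P_def)
        have "k = 0"
          using k ab[of j] ab'[of j] a0[of j] a0'[of j] bp[of j] bp'[of j]
          by (intro int_multiple_less_period[of k "per $ j"]) linarith
        then show ?thesis using k ab[of j] ab'[of j] by simp
      next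
        case False
        then have "P j {a $ j} = P j {a' $ j}"
          using E[of j] nz \<open>\<mu> = \<nu>\<close> by (simp add: face_interval_def)
        moreover have "a $ j \<in> P j {a $ j}" by (auto simp: P_def intro: exI[of _ 0])
        ultimately obtain k :: int where k: "a $ j + of_int k * per $ j = a' $ j"
          by (auto simp: P_def)
        have "k = 0"
          using k ab[of j] ab'[of j] a0[of j] a0'[of j] bp[of j] bp'[of j]
          by (intro int_multiple_less_period[of k "per $ j"]) linarith
        then show ?thesis using k ab[of j] ab'[of j] by simp
      qed
    qed
    \<comment> \<open>The midpoint of the overlap in every coordinate is interior to both
      cells.\<close>
    moreover define m where "m = (\<chi> j. (max (a $ j) (a' $ j) + min (b $ j) (b' $ j)) / 2)"
    ultimately have "a $ j < m $ j \<and> m $ j < b $ j" "a' $ j < m $ j \<and> m $ j < b' $ j" for j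
      by (simp_all add: m_def field_simps) (smt (verit))+
    then have "m \<in> interior K \<inter> interior L"
      by (simp add: K L mem_box_cart)
    then show False using disj by blast
  qed
  then show "edge per K \<nu> = edge per L (- \<nu>)" using eq by simp
  show "area L (- \<nu>) = area K \<nu>" by (fact area_eq)
qed

lemma common_edge_sym:
  assumes "periodic_mesh per \<T>" "K \<in> \<T>" "L \<in> \<T>" "\<nu> \<in> normals" "common_edge per K \<nu> L"
  shows "common_edge per L (- \<nu>) K"
  using common_edge_opposite(1)[OF assms] assms(4,5)
  by (auto simp: common_edge_def edges_def)

section \<open>Sums over interior edges\<close>

text \<open>The double sum in \<open>edge_sum\<close> as one index set, so that edges can be
  reindexed and Cauchy-Schwarz applies to a single sum.\<close>

definition nbrs :: "real ^ 'd \<Rightarrow> 'd cell set \<Rightarrow> 'd cell \<Rightarrow> ((real ^ 'd) \<times> 'd cell) set" where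
  "nbrs per \<T> K = {(\<nu>, L). \<nu> \<in> normals \<and> L \<in> \<T> \<and> common_edge per K \<nu> L}"

lemma periodic_mesh_finite: "periodic_mesh per \<T> \<Longrightarrow> finite \<T>"
  by (simp add: periodic_mesh_def division_of_def)

lemma finite_nbrs: "finite \<T> \<Longrightarrow> finite (nbrs per \<T> K)"
  by (rule finite_subset[of _ "normals \<times> \<T>"]) (auto simp: nbrs_def)

lemma edge_sum_eq_sum_nbrs:
  assumes "finite \<T>"
  shows "edge_sum per \<T> K f = (\<Sum>(\<nu>, L)\<in>nbrs per \<T> K. f \<nu> L)"
proof -
  have "nbrs per \<T> K = Sigma normals (\<lambda>\<nu>. {L \<in> \<T>. common_edge per K \<nu> L})"
    by (auto simp: nbrs_def)
  then show ?thesis unfolding edge_sum_def using assms by (simp add: sum.Sigma)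
qed

text \<open>Every interior edge is visited once from each side, and
  \<open>(K, \<nu>, L) \<mapsto> (L, -\<nu>, K)\<close> is an involution of the visits. All
  summations by parts below rest on this.\<close>

lemma sum_nbrs_swap:
  assumes mesh: "periodic_mesh per \<T>"
  shows "(\<Sum>K\<in>\<T>. \<Sum>(\<nu>, L)\<in>nbrs per \<T> K. f K \<nu> L) =
         (\<Sum>K\<in>\<T>. \<Sum>(\<nu>, L)\<in>nbrs per \<T> K. f L (- \<nu>) K)"
proof -
  let ?S = "Sigma \<T> (nbrs per \<T>)" and ?i = "\<lambda>(K, \<nu>, L). (L, - \<nu>, K)"
  have fin: "finite \<T>" "\<forall>K\<in>\<T>. finite (nbrs per \<T> K)"
    using periodic_mesh_finite[OF mesh] finite_nbrs by auto
  have mem: "?i e \<in> ?S" if "e \<in> ?S" for e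
    using that common_edge_sym[OF mesh] by (auto simp: nbrs_def)
  have "(\<Sum>(K, \<nu>, L)\<in>?S. f K \<nu> L) = (\<Sum>(K, \<nu>, L)\<in>?S. f L (- \<nu>) K)"
    by (rule sum.reindex_bij_witness[of _ ?i ?i]) (use mem in auto)
  then show ?thesis using fin by (simp add: sum.Sigma split_def)
qed

section \<open>Antisymmetry across an edge and discrete duality\<close>

lemma area_nonneg: "0 \<le> area K \<nu>"
  by (simp add: area_def)

lemma normal_vel_opposite: "normal_vel w L (- \<nu>) K = - normal_vel w K \<nu> L"
  by (simp add: normal_vel_def add.commute)

lemma pos_part_uminus: "pos_part (- a) = - neg_part a"
  and neg_part_uminus: "neg_part (- a) = - pos_part a"
  unfolding pos_part_def neg_part_def abs_minus_cancel by argo+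

text \<open>Conservativity of the upwind splitting: inflow into \<open>K\<close> through an edge is
  outflow from \<open>L\<close>, since reversing the normal exchanges positive and negative
  parts.\<close>

lemma w_minus_eq_w_plus: "w_minus u v K \<nu> L = - w_plus u v L (- \<nu>) K"
  unfolding w_minus_def w_plus_def normal_vel_opposite pos_part_uminus neg_part_uminus by simp

text \<open>Duality of the discrete gradient and the centred divergence, that is, discrete
  integration by parts without boundary terms.\<close>

lemma sum_disc_grad_inner:
  assumes mesh: "periodic_mesh per \<T>"
  shows "(\<Sum>K\<in>\<T>. vol K * (disc_grad per \<T> q K \<bullet> w K)) =
         - (\<Sum>K\<in>\<T>. \<Sum>(\<nu>, L)\<in>nbrs per \<T> K. area K \<nu> * (q K * normal_vel w K \<nu> L))"
proof -
  \<comment> \<open>Swapping sides changes the sign of both the jump of \<open>q\<close> and the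
    normal, so \<open>A = B\<close>; it changes the sign of the normal velocity, so
    \<open>F = - G\<close>. Averaging \<open>w\<close> over the two sides gives
    \<open>A + B = G - F\<close>, hence \<open>A = - F\<close>.\<close>
  define A B where "A = (\<Sum>K\<in>\<T>. \<Sum>(\<nu>, L)\<in>nbrs per \<T> K. area K \<nu> * ((q L - q K) / 2) * (w K \<bullet> \<nu>))"
    and "B = (\<Sum>K\<in>\<T>. \<Sum>(\<nu>, L)\<in>nbrs per \<T> K. area K \<nu> * ((q L - q K) / 2) * (w L \<bullet> \<nu>))"
  define F G where "F = (\<Sum>K\<in>\<T>. \<Sum>(\<nu>, L)\<in>nbrs per \<T> K. area K \<nu> * (q K * normal_vel w K \<nu> L))"
    and "G = (\<Sum>K\<in>\<T>. \<Sum>(\<nu>, L)\<in>nbrs per \<T> K. area K \<nu> * (q L * normal_vel w K \<nu> L))"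
  note opp = common_edge_opposite(2)[OF mesh]
  have AB: "A = B"
    unfolding A_def B_def
    by (subst sum_nbrs_swap[OF mesh], intro sum.cong refl)
      (auto simp: nbrs_def opp algebra_simps)
  have FG: "F = - G"
    unfolding F_def G_def sum_negf[symmetric]
    by (subst sum_nbrs_swap[OF mesh], intro sum.cong refl)
      (auto simp: nbrs_def opp normal_vel_opposite)
  have "A + B = G - F"
    unfolding A_def B_def F_def G_def sum.distrib[symmetric] sum_subtractf[symmetric]
    by (intro sum.cong refl) (auto simp: normal_vel_def inner_add_left field_simps)
  have "(\<Sum>K\<in>\<T>. vol K * (disc_grad per \<T> q K \<bullet> w K)) = A"
    unfolding A_def disc_grad_def edge_sum_eq_sum_nbrs[OF periodic_mesh_finite[OF mesh]]
    using vol_pos[OF mesh]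
    by (intro sum.cong refl) (auto simp: inner_sum_left inner_sum_right inner_commute split_def less_imp_neq[symmetric])
  then show ?thesis
    using AB FG \<open>A + B = G - F\<close> unfolding F_def by linarith
qed

section \<open>Local energy balances\<close>

text \<open>Cauchy-Schwarz after splitting each weight as
  \<open>sqrt (c i) * sqrt (c i)\<close>.\<close>

lemma norm_sum_weighted_le:
  fixes x :: "'i \<Rightarrow> 'v::real_inner"
  assumes "\<And>i. i \<in> I \<Longrightarrow> 0 \<le> c i"
  shows "(norm (\<Sum>i\<in>I. c i *\<^sub>R x i))\<^sup>2 \<le> (\<Sum>i\<in>I. c i) * (\<Sum>i\<in>I. c i * (norm (x i))\<^sup>2)"
proof -
  have "norm (\<Sum>i\<in>I. c i *\<^sub>R x i) \<le> (\<Sum>i\<in>I. sqrt (c i) * (sqrt (c i) * norm (x i)))"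
    using assms by (intro sum_norm_le) (simp add: mult.assoc[symmetric])
  then have "(norm (\<Sum>i\<in>I. c i *\<^sub>R x i))\<^sup>2 \<le> (\<Sum>i\<in>I. sqrt (c i) * (sqrt (c i) * norm (x i)))\<^sup>2"
    by (intro power_mono) auto
  also have "\<dots> \<le> (\<Sum>i\<in>I. (sqrt (c i))\<^sup>2) * (\<Sum>i\<in>I. (sqrt (c i) * norm (x i))\<^sup>2)"
    by (rule Cauchy_Schwarz_ineq_sum)
  also have "\<dots> = (\<Sum>i\<in>I. c i) * (\<Sum>i\<in>I. c i * (norm (x i))\<^sup>2)"
    using assms by (simp add: power_mult_distrib)
  finally show ?thesis .
qed

text \<open>The balance of one cell of volume \<open>V\<close>: \<open>i\<close> runs over its
  edges, \<open>b i\<close> and \<open>c i\<close> stand for outgoing and incoming mass fluxes,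
  \<open>y i\<close> for the velocity in the neighbour, \<open>G\<close> for the pressure gradient
  and \<open>\<kappa>\<close> for the inverse square of the Mach number \<open>\<epsilon>\<close>.
  Testing the momentum balance with \<open>u\<close> leaves a remainder in \<open>u' - u\<close>,
  which is estimated by the momentum balance itself.\<close>

lemma cell_kinetic_energy:
  fixes u u' G :: "'v::real_inner" and y :: "'i \<Rightarrow> 'v"
  assumes c: "\<And>i. i \<in> I \<Longrightarrow> 0 \<le> c i" and pos: "0 < V" "0 < r'" "0 < \<tau>"
    and mass: "V * (r' - r) + \<tau> * (\<Sum>i\<in>I. b i - c i) = 0"
    and mom: "V *\<^sub>R (r' *\<^sub>R u' - r *\<^sub>R u) + \<tau> *\<^sub>R (\<Sum>i\<in>I. b i *\<^sub>R u - c i *\<^sub>R y i)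
                + (\<tau> * \<kappa> * V) *\<^sub>R G = 0"
    and cfl: "2 * \<tau> * (\<Sum>i\<in>I. c i) \<le> V * r'"
  shows "V * (r' * (norm u')\<^sup>2 / 2 - r * (norm u)\<^sup>2 / 2)
           + \<tau> * (\<Sum>i\<in>I. b i * (norm u)\<^sup>2 - c i * (norm (y i))\<^sup>2) / 2 + \<tau> * \<kappa> * V * (G \<bullet> u)
         \<le> \<tau>\<^sup>2 * \<kappa>\<^sup>2 * V / r' * (norm G)\<^sup>2"
proof -
  define d where "d = u' - u"
  define S where "S = (\<Sum>i\<in>I. c i *\<^sub>R (y i - u))"
  define Q where "Q = (\<Sum>i\<in>I. c i * (norm (y i - u))\<^sup>2)"
  define B C where "B = (\<Sum>i\<in>I. b i)" and "C = (\<Sum>i\<in>I. c i)"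
  have "0 \<le> Q" unfolding Q_def using c by (intro sum_nonneg) auto
  have mass': "V * (r' - r) = \<tau> * (C - B)"
    using mass by (simp add: sum_subtractf B_def C_def algebra_simps)
  have "(\<Sum>i\<in>I. b i *\<^sub>R u - c i *\<^sub>R y i) = (B - C) *\<^sub>R u - S"
    by (simp add: B_def C_def S_def sum_subtractf scaleR_sum_left algebra_simps)
  \<comment> \<open>Subtracting \<open>u\<close> times the mass balance leaves an equation for the
    increment \<open>d\<close> alone.\<close>
  from mom[unfolded this]
  have "(V * r') *\<^sub>R d + (V * (r' - r) + \<tau> * (B - C)) *\<^sub>R u - \<tau> *\<^sub>R S + (\<tau> * \<kappa> * V) *\<^sub>R G = 0"
    by (simp add: d_def algebra_simps)
  moreover have "V * (r' - r) + \<tau> * (B - C) = 0"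
    using mass' by (simp add: algebra_simps)
  ultimately have "(V * r') *\<^sub>R d - \<tau> *\<^sub>R S + (\<tau> * \<kappa> * V) *\<^sub>R G = 0"
    by (simp only: scaleR_zero_left add_0_right)
  then have d: "(V * r') *\<^sub>R d = \<tau> *\<^sub>R S - (\<tau> * \<kappa> * V) *\<^sub>R G"
    by (simp add: algebra_simps)
  have du: "V * r' * (d \<bullet> u) = \<tau> * (S \<bullet> u) - \<tau> * \<kappa> * V * (G \<bullet> u)"
    using arg_cong[OF d, of "\<lambda>z. z \<bullet> u"] by (simp add: inner_diff_left)
  have u': "(norm u')\<^sup>2 = (norm u)\<^sup>2 + 2 * (d \<bullet> u) + (norm d)\<^sup>2"
    by (simp add: d_def power2_norm_eq_inner inner_diff_left inner_diff_right inner_commute)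
  \<comment> \<open>Expanding around \<open>u\<close> isolates \<open>Q\<close>, the dissipation due
    to upwinding, from the term in \<open>S\<close> that also occurs in the equation for
    \<open>d\<close>.\<close>
  have y: "c i * (norm (y i))\<^sup>2 = c i * (norm (y i - u))\<^sup>2 + 2 * ((c i *\<^sub>R (y i - u)) \<bullet> u) + c i * (norm u)\<^sup>2" for i
    by (simp add: power2_norm_eq_inner inner_diff_left inner_diff_right inner_commute algebra_simps)
  have "(\<Sum>i\<in>I. c i * (norm (y i))\<^sup>2) = Q + 2 * (S \<bullet> u) + C * (norm u)\<^sup>2"
    unfolding y Q_def S_def C_def sum.distrib
    by (simp only: inner_sum_left sum_distrib_left sum_distrib_right)
  then have flux: "(\<Sum>i\<in>I. b i * (norm u)\<^sup>2 - c i * (norm (y i))\<^sup>2)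
      = (B - C) * (norm u)\<^sup>2 - Q - 2 * (S \<bullet> u)"
    unfolding sum_subtractf B_def sum_distrib_right[symmetric] by (simp add: algebra_simps)
  have "V * (r' * (norm u')\<^sup>2 / 2 - r * (norm u)\<^sup>2 / 2)
      = V * (r' - r) * (norm u)\<^sup>2 / 2 + V * r' * (d \<bullet> u) + V * r' * (norm d)\<^sup>2 / 2"
    unfolding u' by (simp add: field_simps)
  also have "\<dots> + \<tau> * ((B - C) * (norm u)\<^sup>2 - Q - 2 * (S \<bullet> u)) / 2 + \<tau> * \<kappa> * V * (G \<bullet> u)
      = V * r' * (norm d)\<^sup>2 / 2 - \<tau> * Q / 2"
    unfolding mass' du by (simp add: field_simps)
  \<comment> \<open>An exact identity: the first term on the right is the error of the explicit
    velocity, the second the upwind dissipation available to absorb it.\<close>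
  finally have balance: "V * (r' * (norm u')\<^sup>2 / 2 - r * (norm u)\<^sup>2 / 2)
        + \<tau> * (\<Sum>i\<in>I. b i * (norm u)\<^sup>2 - c i * (norm (y i))\<^sup>2) / 2 + \<tau> * \<kappa> * V * (G \<bullet> u)
      = V * r' * (norm d)\<^sup>2 / 2 - \<tau> * Q / 2"
    by (simp only: flux)
  \<comment> \<open>The factor 2 lost here is compensated by the factor 2 in \<open>cfl\<close>:
    after division by \<open>V * r'\<close> the bound contains exactly \<open>\<tau> * Q\<close>,
    which cancels in \<open>balance\<close>.\<close>
  have "(norm (p - q))\<^sup>2 \<le> 2 * (norm p)\<^sup>2 + 2 * (norm q)\<^sup>2" for p q :: 'v
    using zero_le_power2[of "norm (p + q)"]
    by (simp add: power2_norm_eq_inner inner_diff_left inner_diff_right inner_add_left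
        inner_add_right inner_commute)
  from this[of "\<tau> *\<^sub>R S" "(\<tau> * \<kappa> * V) *\<^sub>R G"]
  have "(V * r')\<^sup>2 * (norm d)\<^sup>2 \<le> 2 * \<tau>\<^sup>2 * (norm S)\<^sup>2 + 2 * (\<tau> * \<kappa> * V)\<^sup>2 * (norm G)\<^sup>2"
    unfolding d[symmetric] by (simp add: power_mult_distrib)
  also have "2 * \<tau>\<^sup>2 * (norm S)\<^sup>2 \<le> 2 * \<tau>\<^sup>2 * (C * Q)"
    unfolding S_def C_def Q_def by (intro mult_left_mono norm_sum_weighted_le c) auto
  also have "\<dots> = (2 * \<tau> * C) * (\<tau> * Q)" by (simp add: power2_eq_square)
  also have "\<dots> \<le> (V * r') * (\<tau> * Q)"
    using cfl \<open>0 \<le> Q\<close> pos unfolding C_def by (intro mult_right_mono) auto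
  also have "2 * (\<tau> * \<kappa> * V)\<^sup>2 * (norm G)\<^sup>2 = (V * r') * (2 * (\<tau>\<^sup>2 * \<kappa>\<^sup>2 * V / r' * (norm G)\<^sup>2))"
    using pos by (simp add: power2_eq_square)
  finally have "(V * r') * (V * r' * (norm d)\<^sup>2)
      \<le> (V * r') * (\<tau> * Q + 2 * (\<tau>\<^sup>2 * \<kappa>\<^sup>2 * V / r' * (norm G)\<^sup>2))"
    by (simp add: power2_eq_square distrib_left mult.assoc)
  then have "V * r' * (norm d)\<^sup>2 \<le> \<tau> * Q + 2 * (\<tau>\<^sup>2 * \<kappa>\<^sup>2 * V / r' * (norm G)\<^sup>2)"
    using pos by (simp only: mult_le_cancel_left_pos mult_pos_pos)
  with balance show ?thesis by linarith
qed

section \<open>Convexity of the internal energy\<close>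

text \<open>A convex function lies above its tangent at \<open>s\<close>; the coefficient of
  \<open>r - s\<close> is the derivative of \<open>psi \<gamma>\<close> at \<open>s\<close>.\<close>

lemma psi_tangent_le:
  assumes "\<gamma> > 1" "0 < r" "0 < s"
  shows "psi \<gamma> s + \<gamma> / (\<gamma> - 1) * s powr (\<gamma> - 1) * (r - s) \<le> psi \<gamma> r"
proof -
  have deriv: "((\<lambda>x. x powr \<gamma>) has_real_derivative \<gamma> * x powr (\<gamma> - 1)) (at x)"
    "((\<lambda>x. \<gamma> * x powr (\<gamma> - 1)) has_real_derivative \<gamma> * ((\<gamma> - 1) * x powr (\<gamma> - 1 - 1))) (at x)"
    if "x > 0" for x
    by (rule has_real_derivative_powr[OF that]) (rule DERIV_cmult[OF has_real_derivative_powr[OF that]])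
  have "convex_on {0<..} (\<lambda>x. x powr \<gamma>)"
    using assms by (intro f''_ge0_imp_convex[OF _ deriv]) simp_all
  then have "r powr \<gamma> - s powr \<gamma> \<ge> \<gamma> * s powr (\<gamma> - 1) * (r - s)"
    by (rule convex_on_imp_above_tangent)
      (use assms in \<open>simp_all add: interior_open has_field_derivative_at_within deriv\<close>)
  then have "\<gamma> * s powr (\<gamma> - 1) * (r - s) / (\<gamma> - 1) \<le> (r powr \<gamma> - s powr \<gamma>) / (\<gamma> - 1)"
    using assms by (intro divide_right_mono) simp_all
  then show ?thesis by (simp add: psi_def diff_divide_distrib)
qed

text \<open>The thermodynamic relation between pressure, internal energy and its derivative. It
  turns pressure differences into tangent inequalities.\<close>

lemma pressure_eq_psi:
  assumes "\<gamma> > 1" "0 < r"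
  shows "pressure \<gamma> r = r * (\<gamma> / (\<gamma> - 1) * r powr (\<gamma> - 1)) - psi \<gamma> r"
proof -
  have "r * r powr (\<gamma> - 1) = r powr \<gamma>" using assms by (simp add: powr_diff)
  moreover have "\<gamma> / (\<gamma> - 1) = 1 + 1 / (\<gamma> - 1)" using assms by (simp add: field_simps)
  ultimately show ?thesis
    by (simp add: pressure_def psi_def distrib_left distrib_right)
qed

section \<open>The global energy inequality\<close>

text \<open>
  After symmetrisation over the two sides of an edge, the upwind flux exceeds the pressure work
  by nonnegative multiples of the Bregman distances of \<open>psi\<close>.
\<close>

lemma potential_energy_balance:
  fixes u v :: "'d cell \<Rightarrow> real ^ 'd" and r r' :: "'d cell \<Rightarrow> real"
  assumes mesh: "periodic_mesh per \<T>" and \<gamma>: "\<gamma> > 1" and \<tau>: "0 < \<tau>"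
    and pos: "\<And>K. K \<in> \<T> \<Longrightarrow> 0 < r K" "\<And>K. K \<in> \<T> \<Longrightarrow> 0 < r' K"
    and mass: "\<And>K. K \<in> \<T> \<Longrightarrow> vol K * (r' K - r K) + \<tau> * (\<Sum>(\<nu>, L)\<in>nbrs per \<T> K.
        area K \<nu> * (w_plus u v K \<nu> L * r' K + w_minus u v K \<nu> L * r' L)) = 0"
  shows "(\<Sum>K\<in>\<T>. vol K * (psi \<gamma> (r' K) - psi \<gamma> (r K)))
           + \<tau> * (\<Sum>K\<in>\<T>. \<Sum>(\<nu>, L)\<in>nbrs per \<T> K.
               area K \<nu> * (pressure \<gamma> (r' K) * normal_vel (\<lambda>K. u K - v K) K \<nu> L)) \<le> 0"
proof -
  \<comment> \<open>The derivative of \<open>psi \<gamma>\<close> at the new density, used as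
    multiplier of the mass balance. Because it is taken at the new time, convexity bounds the
    increase of \<open>psi\<close> from above.\<close>
  define D where "D K = \<gamma> / (\<gamma> - 1) * r' K powr (\<gamma> - 1)" for K
  define p where "p K = pressure \<gamma> (r' K)" for K
  define b where "b K \<nu> L = area K \<nu> * w_plus u v K \<nu> L" for K \<nu> L
  note opp = common_edge_opposite(2)[OF mesh]
  have tangent: "psi \<gamma> (r' K) - psi \<gamma> (r K) \<le> D K * (r' K - r K)" if "K \<in> \<T>" for K
    using psi_tangent_le[OF \<gamma> pos[OF that], folded D_def] by (simp add: algebra_simps)
  \<comment> \<open>Summation by parts: inflow is rewritten as outflow of the neighbour, so that
    only the nonnegative weights \<open>b\<close> remain, against differences of the test function
    \<open>h\<close>.\<close>
  have flux: "(\<Sum>K\<in>\<T>. \<Sum>(\<nu>, L)\<in>nbrs per \<T> K.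
        area K \<nu> * (w_plus u v K \<nu> L * g K + w_minus u v K \<nu> L * g L) * h K)
      = (\<Sum>K\<in>\<T>. \<Sum>(\<nu>, L)\<in>nbrs per \<T> K. b K \<nu> L * g K * (h K - h L))" (is "?lhs = _") for g h
  proof -
    have "?lhs = (\<Sum>K\<in>\<T>. \<Sum>(\<nu>, L)\<in>nbrs per \<T> K. b K \<nu> L * g K * h K)
        - (\<Sum>K\<in>\<T>. \<Sum>(\<nu>, L)\<in>nbrs per \<T> K. b L (- \<nu>) K * g L * h K)"
      unfolding sum_subtractf[symmetric]
      by (intro sum.cong refl) (auto simp: nbrs_def b_def w_minus_eq_w_plus opp algebra_simps)
    also have "(\<Sum>K\<in>\<T>. \<Sum>(\<nu>, L)\<in>nbrs per \<T> K. b L (- \<nu>) K * g L * h K)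
        = (\<Sum>K\<in>\<T>. \<Sum>(\<nu>, L)\<in>nbrs per \<T> K. b K \<nu> L * g K * h L)"
      by (subst sum_nbrs_swap[OF mesh]) simp
    finally show ?thesis
      by (simp add: sum_subtractf[symmetric] split_def algebra_simps)
  qed
  \<comment> \<open>The pressure work is the upwind flux of the constant 1 tested with
    \<open>p\<close>, so \<open>flux\<close> applies to it too.\<close>
  have "(\<Sum>K\<in>\<T>. \<Sum>(\<nu>, L)\<in>nbrs per \<T> K. area K \<nu> * (p K * normal_vel (\<lambda>K. u K - v K) K \<nu> L))
      = (\<Sum>K\<in>\<T>. \<Sum>(\<nu>, L)\<in>nbrs per \<T> K.
          area K \<nu> * (w_plus u v K \<nu> L * 1 + w_minus u v K \<nu> L * 1) * p K)"
    by (intro sum.cong refl) (auto simp: w_plus_add_w_minus[symmetric])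
  also have "\<dots> = (\<Sum>K\<in>\<T>. \<Sum>(\<nu>, L)\<in>nbrs per \<T> K. b K \<nu> L * 1 * (p K - p L))"
    by (rule flux)
  also have "\<dots> \<le> (\<Sum>K\<in>\<T>. \<Sum>(\<nu>, L)\<in>nbrs per \<T> K. b K \<nu> L * r' K * (D K - D L))"
  proof (intro sum_mono, clarify)
    fix K \<nu> L assume KL: "K \<in> \<T>" "(\<nu>, L) \<in> nbrs per \<T> K"
    then have L: "L \<in> \<T>" by (simp add: nbrs_def)
    \<comment> \<open>By the relation between pressure and \<open>psi\<close>, this is the tangent
      inequality at \<open>r' L\<close>, evaluated at \<open>r' K\<close>.\<close>
    have "p K - p L \<le> r' K * (D K - D L)"
      using psi_tangent_le[OF \<gamma> pos(2)[OF KL(1)] pos(2)[OF L], folded D_def]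
      unfolding p_def pressure_eq_psi[OF \<gamma> pos(2)[OF KL(1)]] pressure_eq_psi[OF \<gamma> pos(2)[OF L]] D_def[symmetric]
      by (simp add: algebra_simps)
    moreover have "0 \<le> b K \<nu> L" by (simp add: b_def area_nonneg w_plus_nonneg)
    ultimately show "b K \<nu> L * 1 * (p K - p L) \<le> b K \<nu> L * r' K * (D K - D L)"
      using mult_left_mono by (fastforce simp: mult.assoc)
  qed
  also have "\<dots> = (\<Sum>K\<in>\<T>. \<Sum>(\<nu>, L)\<in>nbrs per \<T> K.
      area K \<nu> * (w_plus u v K \<nu> L * r' K + w_minus u v K \<nu> L * r' L) * D K)"
    by (rule flux[symmetric])
  finally have "\<tau> * (\<Sum>K\<in>\<T>. \<Sum>(\<nu>, L)\<in>nbrs per \<T> K. area K \<nu> * (p K * normal_vel (\<lambda>K. u K - v K) K \<nu> L))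
      \<le> \<tau> * (\<Sum>K\<in>\<T>. \<Sum>(\<nu>, L)\<in>nbrs per \<T> K.
          area K \<nu> * (w_plus u v K \<nu> L * r' K + w_minus u v K \<nu> L * r' L) * D K)"
    using \<tau> by simp
  also have "\<dots> = (\<Sum>K\<in>\<T>. - (vol K * (D K * (r' K - r K))))"
    unfolding sum_distrib_left[of \<tau>]
  proof (intro sum.cong refl)
    fix K assume "K \<in> \<T>"
    define S where "S = (\<Sum>(\<nu>, L)\<in>nbrs per \<T> K.
        area K \<nu> * (w_plus u v K \<nu> L * r' K + w_minus u v K \<nu> L * r' L))"
    have "\<tau> * S = - (vol K * (r' K - r K))"
      using mass[OF \<open>K \<in> \<T>\<close>] unfolding S_def[symmetric] by linarith
    then have "\<tau> * S * D K = - (vol K * (D K * (r' K - r K)))"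
      by simp
    then show "(\<Sum>x\<in>nbrs per \<T> K. \<tau> * (case x of (\<nu>, L) \<Rightarrow> area K \<nu> * (w_plus u v K \<nu> L * r' K + w_minus u v K \<nu> L * r' L) * D K))
        = - (vol K * (D K * (r' K - r K)))"
      unfolding S_def by (simp add: sum_distrib_left sum_distrib_right split_def algebra_simps)
  qed
  also have "\<dots> \<le> (\<Sum>K\<in>\<T>. - (vol K * (psi \<gamma> (r' K) - psi \<gamma> (r K))))"
    using tangent vol_pos[OF mesh] by (intro sum_mono) (simp add: mult_left_mono less_imp_le)
  finally show ?thesis by (simp add: sum_negf p_def)
qed

text \<open>The kinetic balances are summed over the cells and added to the potential balance
  divided by the square of \<open>\<epsilon>\<close>. The pressure work \<open>A\<close> occurs with
  opposite signs and drops out; the stabilisation contributes \<open>\<eta> * R\<close>, and the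
  kinetic remainder costs \<open>Z\<close>.\<close>

lemma energy_step:
  fixes u u' :: "'d cell \<Rightarrow> real ^ 'd" and r r' :: "'d cell \<Rightarrow> real"
  assumes mesh: "periodic_mesh per \<T>" and \<gamma>: "\<gamma> > 1" and \<tau>: "0 < \<tau>"
    and pos: "\<And>K. K \<in> \<T> \<Longrightarrow> 0 < r K" "\<And>K. K \<in> \<T> \<Longrightarrow> 0 < r' K"
    and v: "v = stab per \<T> \<gamma> \<epsilon> \<eta> \<tau> r'"
    and mass: "\<And>K. K \<in> \<T> \<Longrightarrow> 1 / \<tau> * (r' K - r K) + div_up per \<T> r' u v K = 0"
    and mom: "\<And>K. K \<in> \<T> \<Longrightarrow> (1 / \<tau>) *\<^sub>R (r' K *\<^sub>R u' K - r K *\<^sub>R u K)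
               + div_up per \<T> (\<lambda>K. r' K *\<^sub>R u K) u v K + (1 / \<epsilon>\<^sup>2) *\<^sub>R grad_p per \<T> \<gamma> r' K = 0"
    and cfl: "\<And>K. K \<in> \<T> \<Longrightarrow> 2 * \<tau> * edge_sum per \<T> K
               (\<lambda>\<nu> L. area K \<nu> * r' L * (- w_minus u v K \<nu> L)) \<le> vol K * r' K"
  shows "energy \<T> \<gamma> \<epsilon> r' u' + 1 / \<epsilon> ^ 4 * (\<tau>\<^sup>2 * (\<Sum>K\<in>\<T>. vol K * (\<eta> - 1 / r' K)
           * (norm (grad_p per \<T> \<gamma> r' K))\<^sup>2)) \<le> energy \<T> \<gamma> \<epsilon> r u"
proof -
  define G where "G K = grad_p per \<T> \<gamma> r' K" for K
  define \<kappa> where "\<kappa> = 1 / \<epsilon>\<^sup>2"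
  define N where "N = nbrs per \<T>"
  \<comment> \<open>Outgoing and incoming mass fluxes at the new density. Mass and momentum are
    convected with the same fluxes, the latter carrying the old velocity.\<close>
  define b c where "b K = (\<lambda>(\<nu>, L). area K \<nu> * w_plus u v K \<nu> L * r' K)"
    and "c K = (\<lambda>(\<nu>, L). area K \<nu> * r' L * (- w_minus u v K \<nu> L))" for K
  note opp = common_edge_opposite(2)[OF mesh]
  note edge_sum = edge_sum_eq_sum_nbrs[OF periodic_mesh_finite[OF mesh]]
  have V: "0 < vol K" if "K \<in> \<T>" for K using vol_pos[OF mesh that] .
  have div_r: "vol K * div_up per \<T> r' u v K = (\<Sum>i\<in>N K. b K i - c K i)" if "K \<in> \<T>" for K
  proof -
    have "vol K * div_up per \<T> r' u v K = (\<Sum>(\<nu>, L)\<in>N K.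
        area K \<nu> * (w_plus u v K \<nu> L * r' K + w_minus u v K \<nu> L * r' L))"
      using V[OF that] by (simp add: div_up_def edge_sum N_def)
    also have "\<dots> = (\<Sum>i\<in>N K. b K i - c K i)"
      by (intro sum.cong refl) (auto simp: b_def c_def algebra_simps)
    finally show ?thesis .
  qed
  have div_ru: "vol K *\<^sub>R div_up per \<T> (\<lambda>K. r' K *\<^sub>R u K) u v K
      = (\<Sum>i\<in>N K. b K i *\<^sub>R u K - c K i *\<^sub>R u (snd i))" if "K \<in> \<T>" for K
  proof -
    have "vol K *\<^sub>R div_up per \<T> (\<lambda>K. r' K *\<^sub>R u K) u v K = (\<Sum>(\<nu>, L)\<in>N K. area K \<nu> *\<^sub>R
        (w_plus u v K \<nu> L *\<^sub>R r' K *\<^sub>R u K + w_minus u v K \<nu> L *\<^sub>R r' L *\<^sub>R u L))"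
      using V[OF that] by (simp add: div_up_def edge_sum N_def)
    also have "\<dots> = (\<Sum>i\<in>N K. b K i *\<^sub>R u K - c K i *\<^sub>R u (snd i))"
      by (intro sum.cong refl) (auto simp: b_def c_def algebra_simps)
    finally show ?thesis .
  qed
  have mass': "vol K * (r' K - r K) + \<tau> * (\<Sum>i\<in>N K. b K i - c K i) = 0" if "K \<in> \<T>" for K
  proof -
    have "vol K * (r' K - r K) + \<tau> * (vol K * div_up per \<T> r' u v K)
        = vol K * \<tau> * (1 / \<tau> * (r' K - r K) + div_up per \<T> r' u v K)"
      using \<tau> by (simp add: field_simps)
    then show ?thesis using mass[OF that] div_r[OF that] by simp
  qed
  have mom': "vol K *\<^sub>R (r' K *\<^sub>R u' K - r K *\<^sub>R u K)
      + \<tau> *\<^sub>R (\<Sum>i\<in>N K. b K i *\<^sub>R u K - c K i *\<^sub>R u (snd i)) + (\<tau> * \<kappa> * vol K) *\<^sub>R G K = 0"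
    if "K \<in> \<T>" for K
  proof -
    have "vol K *\<^sub>R (r' K *\<^sub>R u' K - r K *\<^sub>R u K)
        + \<tau> *\<^sub>R (vol K *\<^sub>R div_up per \<T> (\<lambda>K. r' K *\<^sub>R u K) u v K) + (\<tau> * \<kappa> * vol K) *\<^sub>R G K
      = (vol K * \<tau>) *\<^sub>R ((1 / \<tau>) *\<^sub>R (r' K *\<^sub>R u' K - r K *\<^sub>R u K)
        + div_up per \<T> (\<lambda>K. r' K *\<^sub>R u K) u v K + (1 / \<epsilon>\<^sup>2) *\<^sub>R grad_p per \<T> \<gamma> r' K)"
      using \<tau> by (simp add: G_def \<kappa>_def scaleR_add_right mult_ac)
    then show ?thesis using mom[OF that] div_ru[OF that] by simp
  qed
  have kinetic: "vol K * (r' K * (norm (u' K))\<^sup>2 / 2 - r K * (norm (u K))\<^sup>2 / 2)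
      + \<tau> * (\<Sum>i\<in>N K. b K i * (norm (u K))\<^sup>2 - c K i * (norm (u (snd i)))\<^sup>2) / 2
      + \<tau> * \<kappa> * vol K * (G K \<bullet> u K) \<le> \<tau>\<^sup>2 * \<kappa>\<^sup>2 * vol K / r' K * (norm (G K))\<^sup>2" if "K \<in> \<T>" for K
  proof (rule cell_kinetic_energy[OF _ V[OF that] pos(2)[OF that] \<tau> mass'[OF that] mom'[OF that]])
    show "0 \<le> c K i" if "i \<in> N K" for i
      using that w_minus_nonpos[of u v K] pos(2)
      by (auto simp: c_def N_def nbrs_def area_nonneg less_imp_le mult_nonneg_nonpos)
    show "2 * \<tau> * (\<Sum>i\<in>N K. c K i) \<le> vol K * r' K"
      using cfl[OF that] unfolding edge_sum c_def N_def .
  qed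
  \<comment> \<open>The kinetic energy convected out of a cell enters its neighbour, so the total
    vanishes.\<close>
  have flux: "(\<Sum>K\<in>\<T>. \<Sum>i\<in>N K. b K i * (norm (u K))\<^sup>2 - c K i * (norm (u (snd i)))\<^sup>2) = 0"
  proof -
    have "(\<Sum>K\<in>\<T>. \<Sum>i\<in>N K. b K i * (norm (u K))\<^sup>2)
        = (\<Sum>K\<in>\<T>. \<Sum>(\<nu>, L)\<in>nbrs per \<T> K. area K \<nu> * w_plus u v K \<nu> L * r' K * (norm (u K))\<^sup>2)"
      by (simp add: N_def b_def split_def)
    also have "\<dots> = (\<Sum>K\<in>\<T>. \<Sum>i\<in>N K. c K i * (norm (u (snd i)))\<^sup>2)"
      by (subst sum_nbrs_swap[OF mesh], unfold N_def, intro sum.cong refl)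
        (auto simp: nbrs_def c_def opp w_minus_eq_w_plus)
    finally show ?thesis by (simp add: sum_subtractf)
  qed
  define A R where "A = (\<Sum>K\<in>\<T>. vol K * (G K \<bullet> u K))"
    and "R = (\<Sum>K\<in>\<T>. vol K * (norm (G K))\<^sup>2)"
  define dK dP where
    "dK = (\<Sum>K\<in>\<T>. vol K * (r' K * (norm (u' K))\<^sup>2 / 2 - r K * (norm (u K))\<^sup>2 / 2))"
    and "dP = (\<Sum>K\<in>\<T>. vol K * (psi \<gamma> (r' K) - psi \<gamma> (r K)))"
  define Z where "Z = (\<Sum>K\<in>\<T>. vol K / r' K * (norm (G K))\<^sup>2)"
  have "(\<Sum>K\<in>\<T>. vol K * (r' K * (norm (u' K))\<^sup>2 / 2 - r K * (norm (u K))\<^sup>2 / 2)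
      + \<tau> * (\<Sum>i\<in>N K. b K i * (norm (u K))\<^sup>2 - c K i * (norm (u (snd i)))\<^sup>2) / 2
      + \<tau> * \<kappa> * vol K * (G K \<bullet> u K)) \<le> (\<Sum>K\<in>\<T>. \<tau>\<^sup>2 * \<kappa>\<^sup>2 * vol K / r' K * (norm (G K))\<^sup>2)"
    using kinetic by (rule sum_mono)
  also have "\<dots> = \<tau>\<^sup>2 * \<kappa>\<^sup>2 * Z"
    by (simp add: Z_def sum_distrib_left mult.assoc)
  finally have kin: "dK + \<tau> * \<kappa> * A \<le> \<tau>\<^sup>2 * \<kappa>\<^sup>2 * Z"
    using flux
    by (simp only: sum.distrib sum_divide_distrib[symmetric] sum_distrib_left[symmetric] dK_def A_def mult.assoc)
  have "dP + \<tau> * (\<Sum>K\<in>\<T>. \<Sum>(\<nu>, L)\<in>nbrs per \<T> K.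
      area K \<nu> * (pressure \<gamma> (r' K) * normal_vel (\<lambda>K. u K - v K) K \<nu> L)) \<le> 0"
    unfolding dP_def
  proof (rule potential_energy_balance[OF mesh \<gamma> \<tau> pos])
    fix K assume "K \<in> \<T>"
    have "(\<Sum>(\<nu>, L)\<in>nbrs per \<T> K. area K \<nu> * (w_plus u v K \<nu> L * r' K + w_minus u v K \<nu> L * r' L))
        = (\<Sum>i\<in>N K. b K i - c K i)"
      unfolding N_def by (intro sum.cong refl) (auto simp: b_def c_def algebra_simps)
    then show "vol K * (r' K - r K) + \<tau> * (\<Sum>(\<nu>, L)\<in>nbrs per \<T> K.
        area K \<nu> * (w_plus u v K \<nu> L * r' K + w_minus u v K \<nu> L * r' L)) = 0"
      using mass'[OF \<open>K \<in> \<T>\<close>] by simp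
  qed
  also have "(\<Sum>K\<in>\<T>. \<Sum>(\<nu>, L)\<in>nbrs per \<T> K.
      area K \<nu> * (pressure \<gamma> (r' K) * normal_vel (\<lambda>K. u K - v K) K \<nu> L))
      = - (\<Sum>K\<in>\<T>. vol K * (G K \<bullet> (u K - v K)))"
    unfolding G_def grad_p_def sum_disc_grad_inner[OF mesh] by simp
  \<comment> \<open>The stabilisation \<open>v\<close> is \<open>\<eta> * \<tau> * \<kappa>\<close>
    times the pressure gradient, so its work is a multiple of the squared gradient.\<close>
  also have "(\<Sum>K\<in>\<T>. vol K * (G K \<bullet> (u K - v K))) = A - \<eta> * \<tau> * \<kappa> * R"
    by (simp add: A_def R_def v stab_def G_def[symmetric] \<kappa>_def inner_diff_right power2_norm_eq_inner
        sum_subtractf sum_distrib_left algebra_simps)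
  finally have "\<kappa> * (dP + \<tau> * - (A - \<eta> * \<tau> * \<kappa> * R)) \<le> \<kappa> * 0"
    by (intro mult_left_mono) (simp_all add: \<kappa>_def)
  with kin have "dK + \<kappa> * dP + \<kappa>\<^sup>2 * (\<tau>\<^sup>2 * (\<eta> * R - Z)) \<le> 0"
    by (simp add: power2_eq_square algebra_simps)
  moreover have "energy \<T> \<gamma> \<epsilon> r' u' - energy \<T> \<gamma> \<epsilon> r u = dK + \<kappa> * dP"
    unfolding energy_def dK_def dP_def sum_subtractf[symmetric] sum_distrib_left sum.distrib[symmetric]
    by (intro sum.cong refl) (simp add: \<kappa>_def algebra_simps diff_divide_distrib)
  ultimately have "energy \<T> \<gamma> \<epsilon> r' u' + \<kappa>\<^sup>2 * (\<tau>\<^sup>2 * (\<eta> * R - Z)) \<le> energy \<T> \<gamma> \<epsilon> r u"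
    by linarith
  moreover have "\<eta> * R - Z = (\<Sum>K\<in>\<T>. vol K * (\<eta> - 1 / r' K) * (norm (G K))\<^sup>2)"
    unfolding R_def Z_def sum_distrib_left sum_subtractf[symmetric]
    by (intro sum.cong refl) (simp add: algebra_simps)
  moreover have "\<kappa>\<^sup>2 = 1 / \<epsilon> ^ 4"
    by (simp add: \<kappa>_def power_divide power_mult[symmetric])
  ultimately show ?thesis
    unfolding G_def by simp
qed

text \<open>The restriction freed of its quotient. The sum is nonnegative, so it may be multiplied
  out when positive; when it vanishes the left side is 0.\<close>

lemma time_step_condition_imp:
  assumes "time_step_condition per \<T> \<gamma> \<epsilon> \<eta> \<delta>t \<rho> u n K" "0 \<le> vol K * \<rho> (Suc n) K"
    and "\<And>L. L \<in> \<T> \<Longrightarrow> 0 \<le> \<rho> (Suc n) L"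
  shows "2 * \<delta>t * edge_sum per \<T> K (\<lambda>\<nu> L. area K \<nu> * \<rho> (Suc n) L
           * (- w_minus (u n) (stab per \<T> \<gamma> \<epsilon> \<eta> \<delta>t (\<rho> (Suc n))) K \<nu> L)) \<le> vol K * \<rho> (Suc n) K"
proof -
  define S where "S = edge_sum per \<T> K (\<lambda>\<nu> L. area K \<nu> * \<rho> (Suc n) L
           * (- w_minus (u n) (stab per \<T> \<gamma> \<epsilon> \<eta> \<delta>t (\<rho> (Suc n))) K \<nu> L))"
  have "0 \<le> S"
    unfolding S_def edge_sum_def
    by (intro sum_nonneg mult_nonneg_nonneg area_nonneg assms(3))
      (simp_all only: mem_Collect_eq neg_0_le_iff_le w_minus_nonpos)
  have "2 * S \<noteq> 0 \<longrightarrow> \<delta>t \<le> vol K * \<rho> (Suc n) K / (2 * S)"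
    using assms(1) unfolding time_step_condition_def Let_def S_def .
  then have "2 * \<delta>t * S \<le> vol K * \<rho> (Suc n) K"
    using \<open>0 \<le> S\<close> assms(2) by (cases "S = 0") (simp_all add: field_simps)
  then show ?thesis unfolding S_def .
qed

theorem theorem5p14:
  fixes per :: "real ^ 'd" and \<T> :: "'d cell set" and \<gamma> T C\<^sub>0 :: real
    and \<rho>\<^sub>0 :: "real \<Rightarrow> real ^ 'd \<Rightarrow> real" and u\<^sub>0 :: "real \<Rightarrow> real ^ 'd \<Rightarrow> real ^ 'd"
  assumes "CARD('d) \<in> {2, 3}"
    and "periodic_mesh per \<T>"
    and "\<gamma> > 1"
    and "T > 0"
    and "\<And>\<epsilon>. \<epsilon> > 0 \<Longrightarrow> set_integrable lborel (cbox 0 per) (\<rho>\<^sub>0 \<epsilon>)"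
    and "\<And>\<epsilon>. \<epsilon> > 0 \<Longrightarrow> set_integrable lborel (cbox 0 per) (u\<^sub>0 \<epsilon>)"
    and "\<And>\<epsilon> x. \<epsilon> > 0 \<Longrightarrow> x \<in> cbox 0 per \<Longrightarrow> \<rho>\<^sub>0 \<epsilon> x > 0"
    and "\<And>\<epsilon>. \<epsilon> > 0 \<Longrightarrow>
           energy \<T> \<gamma> \<epsilon> (cell_average (\<rho>\<^sub>0 \<epsilon>)) (cell_average (u\<^sub>0 \<epsilon>)) \<le> C\<^sub>0"
  shows "\<exists>C>0. \<forall>\<epsilon>>0. \<forall>\<eta>>0. \<forall>\<delta>t N.
           \<forall>(\<rho> :: nat \<Rightarrow> 'd cell \<Rightarrow> real) (u :: nat \<Rightarrow> 'd cell \<Rightarrow> real ^ 'd).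
             discrete_solution per \<T> \<gamma> \<epsilon> \<eta> T \<delta>t N (\<rho>\<^sub>0 \<epsilon>) (u\<^sub>0 \<epsilon>) \<rho> u \<longrightarrow>
             (\<forall>n<N. \<forall>K\<in>\<T>. \<eta> > 1 / \<rho> (Suc n) K
                \<and> time_step_condition per \<T> \<gamma> \<epsilon> \<eta> \<delta>t \<rho> u n K) \<longrightarrow>
             (\<forall>n\<le>N.
                energy \<T> \<gamma> \<epsilon> (\<rho> n) (u n)
                + 1 / \<epsilon> ^ 4 * (\<Sum>r<n. \<delta>t\<^sup>2 * (\<Sum>K\<in>\<T>. vol K * (\<eta> - 1 / \<rho> (Suc r) K)
                    * (norm (grad_p per \<T> \<gamma> (\<rho> (Suc r)) K))\<^sup>2)) \<le> C)"
\<comment> \<open>The bound on the initial energy serves as constant; the maximum with 1 makes it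
  positive whatever the sign of \<open>C\<^sub>0\<close>.\<close>
proof (intro exI[of _ "max 1 C\<^sub>0"] conjI allI impI)
  fix \<epsilon> \<eta> \<delta>t :: real and N n :: nat
    and \<rho> :: "nat \<Rightarrow> 'd cell \<Rightarrow> real" and u :: "nat \<Rightarrow> 'd cell \<Rightarrow> real ^ 'd"
  assume "0 < \<epsilon>"
    and sol: "discrete_solution per \<T> \<gamma> \<epsilon> \<eta> T \<delta>t N (\<rho>\<^sub>0 \<epsilon>) (u\<^sub>0 \<epsilon>) \<rho> u"
    and cond: "\<forall>n<N. \<forall>K\<in>\<T>. \<eta> > 1 / \<rho> (Suc n) K
      \<and> time_step_condition per \<T> \<gamma> \<epsilon> \<eta> \<delta>t \<rho> u n K"
    and "n \<le> N"
  define I where "I r = (\<Sum>K\<in>\<T>. vol K * (\<eta> - 1 / \<rho> (Suc r) K)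
    * (norm (grad_p per \<T> \<gamma> (\<rho> (Suc r)) K))\<^sup>2)" for r
  have pos: "0 < \<rho> m K" if "m \<le> N" "K \<in> \<T>" for m K
    using sol that by (simp add: discrete_solution_def)
  have step: "energy \<T> \<gamma> \<epsilon> (\<rho> (Suc m)) (u (Suc m)) + 1 / \<epsilon> ^ 4 * (\<delta>t\<^sup>2 * I m)
      \<le> energy \<T> \<gamma> \<epsilon> (\<rho> m) (u m)" if "m < N" for m
    unfolding I_def
  proof (rule energy_step[OF assms(2,3) _ _ _ refl])
    fix K assume K: "K \<in> \<T>"
    show "2 * \<delta>t * edge_sum per \<T> K (\<lambda>\<nu> L. area K \<nu> * \<rho> (Suc m) L
        * (- w_minus (u m) (stab per \<T> \<gamma> \<epsilon> \<eta> \<delta>t (\<rho> (Suc m))) K \<nu> L)) \<le> vol K * \<rho> (Suc m) K"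
    proof (rule time_step_condition_imp)
      show "time_step_condition per \<T> \<gamma> \<epsilon> \<eta> \<delta>t \<rho> u m K" using cond that K by blast
      show "0 \<le> \<rho> (Suc m) L" if "L \<in> \<T>" for L
        using pos[of "Suc m" L] \<open>m < N\<close> that by simp
      then show "0 \<le> vol K * \<rho> (Suc m) K" using vol_pos[OF assms(2) K] K by simp
    qed
  qed (use sol that in \<open>auto simp: discrete_solution_def Let_def\<close>)
  \<comment> \<open>The one-step inequalities telescope down to time 0, where the energy is that of
    the cell averages of the initial data.\<close>
  have "energy \<T> \<gamma> \<epsilon> (\<rho> n) (u n) + 1 / \<epsilon> ^ 4 * (\<Sum>r<n. \<delta>t\<^sup>2 * I r)
      \<le> energy \<T> \<gamma> \<epsilon> (\<rho> 0) (u 0)"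
    using \<open>n \<le> N\<close>
  proof (induction n)
    case (Suc n)
    then show ?case using step[of n] by (simp add: distrib_left)
  qed simp
  also have "energy \<T> \<gamma> \<epsilon> (\<rho> 0) (u 0)
      = energy \<T> \<gamma> \<epsilon> (cell_average (\<rho>\<^sub>0 \<epsilon>)) (cell_average (u\<^sub>0 \<epsilon>))"
    using sol unfolding energy_def discrete_solution_def by (intro sum.cong refl) simp
  also have "\<dots> \<le> max 1 C\<^sub>0" using assms(8)[OF \<open>0 < \<epsilon>\<close>] by simp
  finally show "energy \<T> \<gamma> \<epsilon> (\<rho> n) (u n)
      + 1 / \<epsilon> ^ 4 * (\<Sum>r<n. \<delta>t\<^sup>2 * (\<Sum>K\<in>\<T>. vol K * (\<eta> - 1 / \<rho> (Suc r) K)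
          * (norm (grad_p per \<T> \<gamma> (\<rho> (Suc r)) K))\<^sup>2)) \<le> max 1 C\<^sub>0"
    unfolding I_def .
qed simp

end
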